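(* Let $p$ be a prime and let $q\in\mathbb{C}_p$ with $q\neq 1$ and $|1-q|_p<p^{-1/(p-1)}$. Let $m\ge 0$ be an integer, let $n\in\mathbb{N}$ be a positive integer, let $w_1,\dots,w_n\in\mathbb{N}$ be positive integers, and let $x\in\mathbb{Z}_p$. For $\sigma\in S_n$ define $$C_\sigma=\sum_{l=0}^{m}\binom{m}{l}\left[\prod_{j=1}^{n-1}w_{\sigma(j)}\right]_q^{l-1}\left[w_{\sigma(n)}\right]_q^{m-l}\beta_{l,\,q^{w_{\sigma(1)}\cdots w_{\sigma(n-1)}}}\!\left(w_{\sigma(n)}x\right)\,T_{m,\,q^{w_{\sigma(n)}}}\!\left(w_{\sigma(1)},\dots,w_{\sigma(n-1)}\mid l\right),$$ where $\beta_{l,Q}(\cdot)$ denotes the $l$-th Carlitz $Q$-Bernoulli polynomial and, for positive integers $v_1,\dots,v_{n-1}$ and $0\le l\le m$, $$T_{m,Q}(v_1,\dots,v_{n-1}\mid l)=\sum_{k_1=0}^{v_1-1}\cdots\sum_{k_{n-1}=0}^{v_{n-1}-1} Q^{(l+1)\sum_{j=1}^{n-1}\left(\prod_{1\le i\le n-1,\, i\ne j}v_i\right)k_j}\left[\sum_{j=1}^{n-1}\left(\prod_{1\le i\le n-1,\, i\neq j}v_i\right)k_j\right]_Q^{m-l}.$$ Then $C_\sigma$ is the same for all $\sigma\in S_n$; that is, $C_\sigma=C_\tau$ for all $\sigma,\tau\in S_n$.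
   Context: $\mathbb{Z}_p$ is the ring of $p$-adic integers and $\mathbb{C}_p$ is the completion of an algebraic closure of $\mathbb{Q}_p$, with the $p$-adic norm normalized by $|p|_p=1/p$. $S_n$ is the symmetric group on $\{1,\dots,n\}$. For $Q\in\mathbb{C}_p$ with $Q\ne1$, $|1-Q|_p<p^{-1/(p-1)}$, and $z\in\mathbb{Z}_p$, put $Q^z=\exp(z\log Q)$ ($p$-adic exponential and logarithm) and $[z]_Q=\frac{1-Q^z}{1-Q}$. Every power $Q=q^w$ with $w$ a positive integer and $q$ as in the claim again satisfies $Q\neq1$ and $|1-Q|_p<p^{-1/(p-1)}$. Carlitz $Q$-Bernoulli numbers $\beta_{l,Q}$ ($l\ge0$) are defined recursively by $\beta_{0,Q}=1$ and, for $r\ge1$, $$Q\sum_{l=0}^{r}\binom{r}{l}Q^{l}\beta_{l,Q}-\beta_{r,Q}=\begin{cases}1&\text{if } r=1,\\ 0&\text{if } r>1.\end{cases}$$ Carlitz $Q$-Bernoulli polynomials are $$\beta_{r,Q}(a)=\sum_{l=0}^{r}\binom{r}{l}Q^{la}[a]_Q^{r-l}\beta_{l,Q}\qquad(r\ge0,\ a\in\mathbb{Z}_p).$$ Conventions: $0^0=1$; empty products equal $1$ and empty sums in exponents or brackets equal $0$; when $n=1$ the multiple sum over $k_1,\dots,k_{n-1}$ consists of a single term. *)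

theory Defs
  imports
    "HOL-Analysis.Analysis"
    "HOL-Computational_Algebra.Computational_Algebra"
    "HOL-Combinatorics.Permutations"
begin

text \<open>
  The field of p-adic complex numbers is determined only up to isometric isomorphism.  It enters as
  an arbitrary type that is a completion of an algebraic closure of the p-adic numbers.  The metric
  is that of the absolute value, so series and closures are those of the library.  The library
  restricts \<open>norm\<close> to real normed spaces, hence the separate parameter \<open>absv\<close>.
\<close>

class complete_ultrametric_field = field_char_0 + complete_space +
  fixes absv :: "'a \<Rightarrow> real"
  assumes dist_absv: "dist x y = absv (x - y)"
    and absv_mult: "absv (x * y) = absv x * absv y"
    and absv_add_le_max: "absv (x + y) \<le> max (absv x) (absv y)"

definition is_subfield :: "'a::field set \<Rightarrow> bool" where
  "is_subfield A \<longleftrightarrow> 1 \<in> A \<and> (\<forall>a\<in>A. \<forall>b\<in>A. a - b \<in> A \<and> a * b \<in> A) \<and> (\<forall>a\<in>A. inverse a \<in> A)"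

definition is_algebraic_closure :: "'a::field set \<Rightarrow> 'a set \<Rightarrow> bool" where
  "is_algebraic_closure F A \<longleftrightarrow>
     is_subfield A \<and> F \<subseteq> A \<and>
     (\<forall>a\<in>A. \<exists>P. P \<noteq> 0 \<and> (\<forall>i. coeff P i \<in> F) \<and> poly P a = 0) \<and>
     (\<forall>P. (\<forall>i. coeff P i \<in> A) \<and> degree P > 0 \<longrightarrow> (\<exists>a\<in>A. poly P a = 0))"

text \<open>
  If the ambient complete field induces the p-adic absolute value on the rational numbers, then
  the closure of \<open>\<rat>\<close> is a completion of \<open>\<rat>\<close> for that absolute value.
\<close>

definition padic_numbers :: "'a::complete_ultrametric_field set" where
  "padic_numbers = closure \<rat>"

definition padic_integers :: "'a::complete_ultrametric_field set" where
  "padic_integers = {x \<in> padic_numbers. absv x \<le> 1}"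

definition is_padic_complex :: "nat \<Rightarrow> 'a::complete_ultrametric_field itself \<Rightarrow> bool" where
  "is_padic_complex p _ \<longleftrightarrow>
     (\<forall>k::int. k \<noteq> 0 \<longrightarrow> absv (of_int k :: 'a) = 1 / real p ^ multiplicity (int p) k) \<and>
     (\<exists>A :: 'a set. is_algebraic_closure padic_numbers A \<and> closure A = UNIV)"

definition padic_exp :: "'a::complete_ultrametric_field \<Rightarrow> 'a" where
  "padic_exp z = (\<Sum>k. z ^ k / fact k)"

definition padic_log :: "'a::complete_ultrametric_field \<Rightarrow> 'a" where
  "padic_log u = (\<Sum>k. (- 1) ^ k * (u - 1) ^ Suc k / of_nat (Suc k))"

definition padic_power :: "'a::complete_ultrametric_field \<Rightarrow> 'a \<Rightarrow> 'a" where
  "padic_power Q z = padic_exp (z * padic_log Q)"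

definition q_bracket :: "'a::complete_ultrametric_field \<Rightarrow> 'a \<Rightarrow> 'a" where
  "q_bracket Q z = (1 - padic_power Q z) / (1 - Q)"

definition carlitz_recurrence :: "'a::field \<Rightarrow> (nat \<Rightarrow> 'a) \<Rightarrow> bool" where
  "carlitz_recurrence Q b \<longleftrightarrow> b 0 = 1 \<and>
     (\<forall>r\<ge>1. Q * (\<Sum>l\<le>r. of_nat (r choose l) * Q ^ l * b l) - b r = (if r = 1 then 1 else 0))"

text \<open>
  The coefficient of \<open>b r\<close> in the recurrence is \<open>Q ^ Suc r - 1\<close>; hence the recurrence
  has exactly one solution as soon as \<open>Q\<close> is not a root of unity (see below).
\<close>

definition carlitz_number :: "'a::field \<Rightarrow> nat \<Rightarrow> 'a" where
  "carlitz_number Q = (THE b. carlitz_recurrence Q b)"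

definition carlitz_poly :: "nat \<Rightarrow> 'a::complete_ultrametric_field \<Rightarrow> 'a \<Rightarrow> 'a" where
  "carlitz_poly r Q a =
     (\<Sum>l\<le>r. of_nat (r choose l) * padic_power Q (of_nat l * a) * q_bracket Q a ^ (r - l)
            * carlitz_number Q l)"

text \<open>
  Here \<open>d\<close> is the number of arguments \<open>v 1, \<dots>, v d\<close>.  The multiple sum runs over the
  extensional functions \<open>k\<close> on \<open>{1..d}\<close> with \<open>k j < v j\<close>; for \<open>d = 0\<close>
  there is exactly one.
\<close>

definition T_exponent :: "nat \<Rightarrow> (nat \<Rightarrow> nat) \<Rightarrow> (nat \<Rightarrow> nat) \<Rightarrow> nat" where
  "T_exponent d v k = (\<Sum>j=1..d. (\<Prod>i\<in>{1..d} - {j}. v i) * k j)"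

definition T_sum ::
  "nat \<Rightarrow> 'a::complete_ultrametric_field \<Rightarrow> nat \<Rightarrow> (nat \<Rightarrow> nat) \<Rightarrow> nat \<Rightarrow> 'a" where
  "T_sum m Q d v l =
     (\<Sum>k \<in> PiE {1..d} (\<lambda>j. {..<v j}).
        Q ^ ((l + 1) * T_exponent d v k) * q_bracket Q (of_nat (T_exponent d v k)) ^ (m - l))"

definition C_sum ::
  "nat \<Rightarrow> nat \<Rightarrow> (nat \<Rightarrow> nat) \<Rightarrow> 'a::complete_ultrametric_field \<Rightarrow> 'a \<Rightarrow> (nat \<Rightarrow> nat) \<Rightarrow> 'a" where
  "C_sum m n w q x \<sigma> =
     (\<Sum>l\<le>m. of_nat (m choose l)
        * q_bracket q (of_nat (\<Prod>j=1..n-1. w (\<sigma> j))) powi (int l - 1)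
        * q_bracket q (of_nat (w (\<sigma> n))) ^ (m - l)
        * carlitz_poly l (q ^ (\<Prod>j=1..n-1. w (\<sigma> j))) (of_nat (w (\<sigma> n)) * x)
        * T_sum m (q ^ w (\<sigma> n)) (n - 1) (\<lambda>j. w (\<sigma> j)) l)"

lemma carlitz_recurrence_step:
  fixes Q :: "'a::field"
  shows "Q * (\<Sum>l\<le>Suc r. of_nat (Suc r choose l) * Q ^ l * b l) - b (Suc r)
       = (Q ^ Suc (Suc r) - 1) * b (Suc r)
         + Q * (\<Sum>l\<le>r. of_nat (Suc r choose l) * Q ^ l * b l)"
  by (simp add: algebra_simps)

lemma carlitz_recurrence_ex1:
  fixes Q :: "'a::field"
  assumes Q: "\<And>r. r > 0 \<Longrightarrow> Q ^ r \<noteq> 1"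
  shows "\<exists>!b. carlitz_recurrence Q b"
proof -
  define G where "G f r = ((if Suc r = 1 then 1 else 0)
      - Q * (\<Sum>l\<le>r. of_nat (Suc r choose l) * Q ^ l * f l)) / (Q ^ Suc (Suc r) - 1)"
    for f :: "nat \<Rightarrow> 'a" and r
  have G_cong: "G f r = G g r" if "\<And>l. l \<le> r \<Longrightarrow> f l = g l" for f g r
  proof -
    have "(\<Sum>l\<le>r. of_nat (Suc r choose l) * Q ^ l * f l)
        = (\<Sum>l\<le>r. of_nat (Suc r choose l) * Q ^ l * g l)"
      by (rule sum.cong) (simp_all add: that)
    then show ?thesis
      by (simp only: G_def)
  qed
  have shift: "(\<forall>r\<ge>1. P r) \<longleftrightarrow> (\<forall>r. P (Suc r))" for P :: "nat \<Rightarrow> bool"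
    by (auto simp: Suc_le_eq gr0_conv_Suc)
  have solve: "d * y + s = e \<longleftrightarrow> y = (e - s) / d" if "d \<noteq> 0" for d y s e :: 'a
    using that by (auto simp: field_simps)
  have nz: "Q ^ Suc (Suc r) - 1 \<noteq> 0" for r
    using Q[of "Suc (Suc r)"] by simp
  have rec: "carlitz_recurrence Q b \<longleftrightarrow> b 0 = 1 \<and> (\<forall>r. b (Suc r) = G b r)" for b
    unfolding carlitz_recurrence_def shift carlitz_recurrence_step solve[OF nz] G_def ..
  define F where "F f r = (case r of 0 \<Rightarrow> 1 | Suc s \<Rightarrow> G f s)" for f r
  have "adm_wf less_than F"
    unfolding adm_wf_def F_def by (auto split: nat.split intro!: G_cong)
  then have "wfrec less_than F = F (wfrec less_than F)"
    by (rule wfrec_fixpoint[OF wf_less_than])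
  then have unfold: "wfrec less_than F r = F (wfrec less_than F) r" for r
    by (rule fun_cong)
  have ex: "carlitz_recurrence Q (wfrec less_than F)"
    unfolding rec
  proof (intro conjI allI)
    show "wfrec less_than F 0 = 1"
      by (rule trans[OF unfold]) (simp only: F_def nat.case)
    show "wfrec less_than F (Suc r) = G (wfrec less_than F) r" for r
      by (rule trans[OF unfold]) (simp only: F_def nat.case)
  qed
  have "b = b'" if "carlitz_recurrence Q b" "carlitz_recurrence Q b'" for b b'
  proof
    show "b r = b' r" for r
    proof (induction r rule: less_induct)
      case (less r)
      show ?case
      proof (cases r)
        case 0
        with that show ?thesis by (simp add: rec)
      next
        case (Suc s)
        have "G b s = G b' s"
          using less Suc by (intro G_cong) simp
        with that Suc show ?thesis by (simp add: rec)
      qed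
    qed
  qed
  with ex show ?thesis by blast
qed

lemma carlitz_number_recurrence:
  fixes Q :: "'a::field"
  assumes "\<And>r. r > 0 \<Longrightarrow> Q ^ r \<noteq> 1"
  shows "carlitz_recurrence Q (carlitz_number Q)"
  unfolding carlitz_number_def using theI'[OF carlitz_recurrence_ex1[OF assms]] by blast

end

theory Submission imports Defs begin

text \<open>
  With \<open>c\<^sub>i = (i + 1) (1 - Q) / (1 - Q ^ (i + 1))\<close>, the Carlitz numbers are
  \<open>(1 - Q) ^ (-l)\<close> times the alternating binomial transform of \<open>c\<close>.  The sum over \<open>l\<close> in
  \<open>C\<^sub>\<sigma>\<close> collapses by the binomial theorem, the multiple sum over \<open>k\<close> factors into geometric
  sums, and with \<open>W = w\<^sub>1 \<cdots> w\<^sub>n\<close> everything becomes symmetric in the weights: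
  \<open>C\<^sub>\<sigma>\<close> equals \<open>(1 - q) ^ (1 - m)\<close> times the sum over \<open>i \<le> m\<close> of
  \<open>(-1) ^ i (m choose i) q ^ (i W x) (i + 1) (1 - q ^ ((i + 1) W)) ^ (n - 1)
  / (\<Prod>j. 1 - q ^ ((i + 1) W / w\<^sub>j))\<close>.

  The analytic input is \<open>q ^ z q ^ z' = q ^ (z + z')\<close>, that \<open>q ^ z\<close> is the ordinary power for
  natural \<open>z\<close>, and that \<open>q\<close> is not a root of unity.  Instead of composing the series of \<open>exp\<close>
  and \<open>log\<close>, we compare both with \<open>N\<close>-th powers for \<open>N = p ^ k\<close>: the estimate
  \<open>\<bar>u ^ N - 1 - N log u\<bar> \<le> \<bar>N\<bar>\<^sup>2\<close> determines the logarithm.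
\<close>

subsection \<open>Ultrametric absolute values\<close>

lemma absv_zero [simp]: "absv (0 :: 'a::complete_ultrametric_field) = 0"
  using dist_absv[of "0::'a" 0] by simp

lemma absv_eq_zero_iff [simp]:
  fixes x :: "'a::complete_ultrametric_field"
  shows "absv x = 0 \<longleftrightarrow> x = 0"
  by (metis diff_zero dist_absv dist_eq_0_iff)

lemma absv_nonneg [simp]:
  fixes x :: "'a::complete_ultrametric_field"
  shows "0 \<le> absv x"
  using zero_le_dist[of x 0] dist_absv[of x 0] by simp

lemma absv_pos_iff [simp]:
  fixes x :: "'a::complete_ultrametric_field"
  shows "0 < absv x \<longleftrightarrow> x \<noteq> 0"
  using absv_nonneg[of x] absv_eq_zero_iff[of x] by linarith

lemma absv_one [simp]: "absv (1 :: 'a::complete_ultrametric_field) = 1"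
  using absv_mult[of "1::'a" 1] by simp

lemma absv_minus_commute:
  fixes x y :: "'a::complete_ultrametric_field"
  shows "absv (x - y) = absv (y - x)"
  using dist_commute[of x y] by (simp add: dist_absv)

lemma absv_uminus [simp]:
  fixes x :: "'a::complete_ultrametric_field"
  shows "absv (- x) = absv x"
  using absv_minus_commute[of 0 x] by simp

lemma absv_power:
  fixes x :: "'a::complete_ultrametric_field"
  shows "absv (x ^ k) = absv x ^ k"
  by (induction k) (simp_all add: absv_mult)

lemma absv_divide:
  fixes x y :: "'a::complete_ultrametric_field"
  shows "absv (x / y) = absv x / absv y"
proof (cases "y = 0")
  case False
  then have "absv x = absv (x / y) * absv y"
    by (simp add: absv_mult[symmetric])
  with False show ?thesis by simp
qed simp

lemma absv_add_le:
  fixes x y :: "'a::complete_ultrametric_field"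
  shows "absv x \<le> B \<Longrightarrow> absv y \<le> B \<Longrightarrow> absv (x + y) \<le> B"
  using absv_add_le_max[of x y] by simp

lemma absv_diff_le:
  fixes x y :: "'a::complete_ultrametric_field"
  shows "absv x \<le> B \<Longrightarrow> absv y \<le> B \<Longrightarrow> absv (x - y) \<le> B"
  using absv_add_le[of x B "- y"] by simp

lemma absv_diff_trans:
  fixes x y z :: "'a::complete_ultrametric_field"
  shows "absv (x - y) \<le> B \<Longrightarrow> absv (y - z) \<le> B \<Longrightarrow> absv (x - z) \<le> B"
  using absv_add_le[of "x - y" B "y - z"] by simp

lemma absv_mult_diff_le:
  fixes a a' b b' :: "'a::complete_ultrametric_field"
  assumes "absv (a - a') \<le> B" "absv (b - b') \<le> B" "absv a \<le> 1" "absv b' \<le> 1"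
  shows "absv (a * b - a' * b') \<le> B"
proof -
  have "absv (a * (b - b')) \<le> B" "absv ((a - a') * b') \<le> B"
    using assms mult_mono[of "absv a" 1 "absv (b - b')" B] mult_mono[of "absv (a - a')" B "absv b'" 1]
    by (auto simp: absv_mult intro: order_trans[OF absv_nonneg])
  then have "absv (a * (b - b') + (a - a') * b') \<le> B"
    by (rule absv_add_le)
  then show ?thesis
    by (simp add: algebra_simps)
qed

lemma absv_sum_le:
  fixes f :: "'b \<Rightarrow> 'a::complete_ultrametric_field"
  shows "0 \<le> B \<Longrightarrow> (\<And>i. i \<in> A \<Longrightarrow> absv (f i) \<le> B) \<Longrightarrow> absv (sum f A) \<le> B"
  by (induction A rule: infinite_finite_induct) (auto intro: absv_add_le)

text \<open>The isosceles triangle principle: in the ultrametric bound for either of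
  \<open>x\<close>, \<open>y\<close> by the other and their difference, the difference is too small
  to be what bounds \<open>y\<close>, and at most \<open>absv y\<close> for
  \<open>x\<close>.\<close>

lemma absv_eq_of_close:
  fixes x y :: "'a::complete_ultrametric_field"
  assumes "absv (x - y) < absv y"
  shows "absv x = absv y"
  using absv_add_le_max[of "x - y" y] absv_add_le_max[of "y - x" x] assms absv_minus_commute[of x y]
  by (auto simp: max_def split: if_splits)

section \<open>Series whose terms tend to zero\<close>

lemma absv_sum_diff_le:
  fixes f :: "nat \<Rightarrow> 'a::complete_ultrametric_field"
  assumes "0 \<le> B" "\<And>k. k \<ge> N \<Longrightarrow> absv (f k) \<le> B" "N \<le> n"
  shows "absv (sum f {..<n} - sum f {..<N}) \<le> B"
proof -
  have "sum f {..<n} - sum f {..<N} = sum f {N..<n}"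
    using sum_diff[of "{..<n}" "{..<N}" f] assms(3) by (simp add: lessThan_minus_lessThan)
  then show ?thesis
    using assms by (auto intro: absv_sum_le)
qed

text \<open>Terms tending to 0 suffice for convergence, since a block of late terms is bounded by
  its largest member; this makes the partial sums Cauchy.\<close>

lemma sums_suminf_absv:
  fixes f :: "nat \<Rightarrow> 'a::complete_ultrametric_field"
  assumes "(\<lambda>k. absv (f k)) \<longlonglongrightarrow> 0"
  shows "(\<lambda>n. sum f {..<n}) \<longlonglongrightarrow> suminf f"
proof -
  have "Cauchy (\<lambda>n. sum f {..<n})"
  proof (rule metric_CauchyI)
    fix e :: real assume e: "0 < e"
    then obtain N where N: "\<And>k. k \<ge> N \<Longrightarrow> absv (f k) < e / 2"
      using assms unfolding LIMSEQ_def dist_real_def by (metis abs_of_nonneg absv_nonneg diff_zero half_gt_zero)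
    have "absv (sum f {..<n} - sum f {..<N}) \<le> e / 2" if "n \<ge> N" for n
      using e N that by (intro absv_sum_diff_le) (auto intro: less_imp_le)
    then have "absv (sum f {..<m} - sum f {..<n}) \<le> e / 2" if "m \<ge> N" "n \<ge> N" for m n
      using that absv_diff_trans[of _ "sum f {..<N}"] absv_minus_commute by metis
    then show "\<exists>M. \<forall>m\<ge>M. \<forall>n\<ge>M. dist (sum f {..<m}) (sum f {..<n}) < e"
      using e by (intro exI[of _ N]) (force simp: dist_absv)
  qed
  then have "summable f"
    by (simp add: summable_iff_convergent Cauchy_convergent_iff)
  then show ?thesis
    using summable_sums sums_def by blast
qed

lemma absv_suminf_diff_le:
  fixes f :: "nat \<Rightarrow> 'a::complete_ultrametric_field"
  assumes "(\<lambda>k. absv (f k)) \<longlonglongrightarrow> 0" "\<And>k. k \<ge> N \<Longrightarrow> absv (f k) \<le> B"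
  shows "absv (suminf f - sum f {..<N}) \<le> B"
proof (rule field_le_epsilon)
  fix e :: real assume e: "0 < e"
  have B: "0 \<le> B"
    using assms(2)[of N] absv_nonneg order_trans by blast
  obtain n where n: "n \<ge> N" "absv (sum f {..<n} - suminf f) < e"
    using metric_LIMSEQ_D[OF sums_suminf_absv[OF assms(1)] e] unfolding dist_absv
    by (meson nle_le)
  have "absv (sum f {..<n} - sum f {..<N}) \<le> B"
    using B assms(2) n(1) by (rule absv_sum_diff_le)
  then have "absv (sum f {..<n} - sum f {..<N}) \<le> B + e"
    using e by linarith
  moreover have "absv (suminf f - sum f {..<n}) \<le> B + e"
    using n(2) B by (subst absv_minus_commute) linarith
  ultimately show "absv (suminf f - sum f {..<N}) \<le> B + e"
    by (rule absv_diff_trans[rotated])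
qed

text \<open>Identities between values of series are obtained from this: the difference of the two
  sides is bounded by a geometric sequence.\<close>

lemma eq_zero_if_absv_le_powers:
  fixes x :: "'a::complete_ultrametric_field"
  assumes "0 \<le> \<theta>" "\<theta> < 1" "\<And>k. absv x \<le> C * \<theta> ^ k"
  shows "x = 0"
proof -
  have "(\<lambda>k. C * \<theta> ^ k) \<longlonglongrightarrow> 0"
    using assms(1,2) by (intro tendsto_mult_right_zero LIMSEQ_power_zero) simp
  then have "absv x \<le> 0"
    by (rule LIMSEQ_le_const) (use assms(3) in blast)
  then show ?thesis
    using order_antisym[OF _ absv_nonneg] absv_eq_zero_iff by blast
qed

subsection \<open>The p-adic exponential and logarithm\<close>

text \<open>Legendre's formula in recursive form: the multiples of \<open>p\<close> up to
  \<open>n\<close> are \<open>p\<close> times 1, ..., \<open>n div p\<close>. In the induction both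
  sides change only when \<open>p\<close> divides \<open>Suc n\<close>.\<close>

lemma multiplicity_fact:
  assumes "prime p"
  shows "multiplicity (int p) (fact n) = n div p + multiplicity (int p) (fact (n div p))"
proof (induction n)
  case (Suc n)
  have p: "prime_elem (int p)" "p > 0"
    using assms prime_gt_0_nat by auto
  show ?case
  proof (cases "p dvd Suc n")
    case False
    then have "\<not> int p dvd int (Suc n)"
      by (simp only: int_dvd_int_iff not_False_eq_True)
    then have "multiplicity (int p) (int (Suc n)) = 0"
      by (rule not_dvd_imp_multiplicity_0)
    moreover have "Suc n div p = n div p"
      using False by (simp add: div_Suc dvd_eq_mod_eq_0)
    ultimately show ?thesis
      using Suc p by (simp add: prime_elem_multiplicity_mult_distrib del: of_nat_Suc)
  next
    case True
    then obtain k where k: "Suc n = p * k" by blast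
    then obtain j where j: "k = Suc j" by (cases k) auto
    have n_eq: "n = (p - 1) + p * j"
      using k p(2) unfolding j by (simp; arith)
    have "n div p = j"
      unfolding n_eq using p(2) by (subst div_mult_self2) auto
    moreover have "Suc n div p = Suc j"
      using p(2) k j by simp
    ultimately have n: "n div p = j" "Suc n div p = Suc j" .
    have "multiplicity (int p) (int (Suc n)) = Suc (multiplicity (int p) (int k))"
      using p(1) unfolding k of_nat_mult
      by (subst prime_elem_multiplicity_mult_distrib) (use j in auto)
    then show ?thesis
      using Suc p unfolding n by (simp add: prime_elem_multiplicity_mult_distrib j del: of_nat_Suc)
  qed
qed simp

text \<open>With \<open>k = n div p\<close>, the recursion and the bound for \<open>k\<close> give
  less than \<open>(p - 1) * k + k\<close>, which is \<open>k * p\<close> and so at most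
  \<open>n\<close>.\<close>

lemma multiplicity_fact_less:
  assumes "prime p" "n > 0"
  shows "(p - 1) * multiplicity (int p) (fact n) < n"
  using assms(2)
proof (induction n rule: less_induct)
  case (less n)
  define k where "k = n div p"
  have p: "p > 1" using assms(1) prime_gt_1_nat by auto
  have eq: "multiplicity (int p) (fact n) = k + multiplicity (int p) (fact k)"
    unfolding k_def by (rule multiplicity_fact[OF assms(1)])
  show ?case
  proof (cases "k = 0")
    case True
    with eq less show ?thesis by simp
  next
    case False
    moreover have "k < n" using p less by (simp add: k_def)
    ultimately have "(p - 1) * multiplicity (int p) (fact n) < (p - 1) * k + k"
      using less by (simp add: eq algebra_simps)
    also have "\<dots> = k * p" using p by (cases p) (auto simp: algebra_simps)
    also have "\<dots> \<le> n" by (simp add: k_def)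
    finally show ?thesis .
  qed
qed

section \<open>The exponential on its disc of convergence\<close>

definition exp_radius :: "nat \<Rightarrow> real" where
  "exp_radius p = real p powr (- (1 / (real p - 1)))"

locale padic_complex =
  fixes p :: nat and ty :: "'a::complete_ultrametric_field itself"
  assumes prime: "prime p" and padic: "is_padic_complex p ty"
begin

abbreviation \<rho> :: real where "\<rho> \<equiv> exp_radius p"

lemma radius_pos: "0 < \<rho>"
  using prime_gt_0_nat[OF prime] by (simp add: exp_radius_def)

lemma radius_le_1: "\<rho> \<le> 1"
  using prime_gt_1_nat[OF prime] powr_mono[of "- (1 / (real p - 1))" 0 "real p"]
  by (simp add: exp_radius_def)

lemma absv_of_int: "k \<noteq> 0 \<Longrightarrow> absv (of_int k :: 'a) = 1 / real p ^ multiplicity (int p) k"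
  using padic by (simp add: is_padic_complex_def)

lemma absv_of_nat: "n \<noteq> 0 \<Longrightarrow> absv (of_nat n :: 'a) = 1 / real p ^ multiplicity (int p) (int n)"
  using absv_of_int[of "int n"] by simp

lemma absv_of_nat_le_1: "absv (of_nat n :: 'a) \<le> 1"
  using absv_of_nat[of n] prime_gt_0_nat[OF prime] by (cases "n = 0") auto

lemma absv_of_nat_mult_le: "absv (of_nat n * x :: 'a) \<le> absv x"
  unfolding absv_mult by (intro mult_left_le_one_le absv_nonneg absv_of_nat_le_1)

lemma absv_of_nat_prime_power: "absv (of_nat (p ^ k) :: 'a) = (1 / real p) ^ k"
  using prime_gt_0_nat[OF prime] absv_of_nat[of p] prime
  by (simp add: absv_power power_one_over)

text \<open>The strict inequality of \<open>multiplicity_fact_less\<close> gives the exponent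
  \<open>k\<close> rather than \<open>Suc k\<close>. The power saved is what leaves a factor
  \<open>absv z\<close> in front of the geometric bounds for the terms of \<open>exp\<close> and
  \<open>log\<close>.\<close>

lemma radius_power_le_absv_fact: "\<rho> ^ k \<le> absv (fact (Suc k) :: 'a)"
proof -
  define v where "v = multiplicity (int p) (fact (Suc k))"
  have p: "real p > 1" using prime_gt_1_nat[OF prime] by simp
  have "(p - 1) * v < Suc k"
    unfolding v_def by (rule multiplicity_fact_less[OF prime]) simp
  then have "real ((p - 1) * v) \<le> real k"
    by linarith
  then have v: "real v \<le> real k / (real p - 1)"
    using p by (simp add: of_nat_diff field_simps)
  have "\<rho> ^ k = real p powr (- (real k / (real p - 1)))"
    using p by (simp add: exp_radius_def powr_realpow[symmetric] powr_powr)
  also have "\<dots> \<le> real p powr (- real v)"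
    using p v by (intro powr_mono) auto
  also have "\<dots> = 1 / real p ^ v"
    using p by (simp add: powr_minus powr_realpow divide_simps)
  also have "\<dots> = absv (fact (Suc k) :: 'a)"
    using absv_of_int[of "fact (Suc k)"] unfolding v_def by (simp only: of_int_fact fact_nonzero not_False_eq_True)
  finally show ?thesis .
qed

lemma absv_power_div_fact_Suc: "absv (z ^ k / fact (Suc k) :: 'a) \<le> (absv z / \<rho>) ^ k"
  using radius_power_le_absv_fact[of k] radius_pos
  by (auto simp: absv_divide absv_power power_divide intro!: divide_left_mono mult_pos_pos
      intro: less_le_trans[OF zero_less_power])

lemma absv_power_Suc_div_fact_le:
  "absv (z ^ Suc k / fact (Suc k) :: 'a) \<le> absv z * (absv z / \<rho>) ^ k"
  using mult_left_mono[OF absv_power_div_fact_Suc[of z k] absv_nonneg[of z]]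
  by (simp only: absv_mult[symmetric] power_Suc times_divide_eq_right)

lemma absv_exp_term_le: "absv (z ^ k / fact k :: 'a) \<le> (absv z / \<rho>) ^ k"
proof (cases k)
  case (Suc j)
  have "absv z \<le> absv z / \<rho>"
    using radius_pos radius_le_1 mult_left_mono[of \<rho> 1 "absv z"] by (simp add: field_simps)
  then have "absv z * (absv z / \<rho>) ^ j \<le> absv z / \<rho> * (absv z / \<rho>) ^ j"
    using radius_pos by (intro mult_right_mono) auto
  with absv_power_Suc_div_fact_le[of _ j] show ?thesis
    unfolding Suc power_Suc[of "absv z / \<rho>"] by (rule order_trans)
qed simp

lemma ratio_power_tendsto_0:
  assumes "absv (z :: 'a) < \<rho>"
  shows "(\<lambda>k. (absv z / \<rho>) ^ k) \<longlonglongrightarrow> 0"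
  using assms radius_pos by (intro LIMSEQ_power_zero) (simp add: field_simps)

lemma ratio_power_le_1:
  assumes "absv (z :: 'a) < \<rho>"
  shows "(absv z / \<rho>) ^ k \<le> 1"
  using assms radius_pos by (intro power_le_one) auto

lemma absv_le_geometric_tendsto_0:
  assumes "absv (z :: 'a) < \<rho>" "\<And>k. absv (f k :: 'a) \<le> (absv z / \<rho>) ^ k"
  shows "(\<lambda>k. absv (f k)) \<longlonglongrightarrow> 0"
  by (rule tendsto_sandwich[OF _ _ tendsto_const ratio_power_tendsto_0[OF assms(1)]])
     (use assms(2) in auto)

lemma absv_padic_exp_diff_le:
  assumes "absv (z :: 'a) < \<rho>" "\<And>k. k \<ge> N \<Longrightarrow> absv (z ^ k / fact k) \<le> B"
  shows "absv (padic_exp z - (\<Sum>k<N. z ^ k / fact k)) \<le> B"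
  unfolding padic_exp_def
  using absv_le_geometric_tendsto_0[OF assms(1) absv_exp_term_le] assms(2)
  by (rule absv_suminf_diff_le)

lemma absv_padic_exp_minus_1_le:
  assumes "absv (z :: 'a) < \<rho>"
  shows "absv (padic_exp z - 1) \<le> absv z"
proof -
  have "absv (z ^ k / fact k) \<le> absv z" if k: "k \<ge> 1" for k
  proof -
    obtain j where j: "k = Suc j" using k by (cases k) auto
    show ?thesis
      unfolding j using absv_power_Suc_div_fact_le[of _ j] ratio_power_le_1[OF assms, of j]
        mult_left_mono[of _ 1 "absv z"] by (fastforce intro: order_trans)
  qed
  from absv_padic_exp_diff_le[OF assms this, of 1] show ?thesis by simp
qed

text \<open>From the quadratic term on, two factors \<open>absv z\<close> can be split off. For
  \<open>z\<close> equal to \<open>N\<close> times a fixed element of the disc the error is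
  quadratic in \<open>absv N\<close>, matching the estimate for \<open>u ^ N\<close>.\<close>

lemma absv_padic_exp_minus_linear_le:
  assumes "absv (z :: 'a) < \<rho>"
  shows "absv (padic_exp z - 1 - z) \<le> (absv z)\<^sup>2 / \<rho>"
proof -
  have "absv (z ^ k / fact k) \<le> (absv z)\<^sup>2 / \<rho>" if k: "k \<ge> 2" for k
  proof -
    obtain j where j: "k = Suc (Suc j)" using k by (metis add_2_eq_Suc le_Suc_ex)
    have "absv (z ^ k / fact k) \<le> absv z * (absv z / \<rho>) ^ Suc j"
      unfolding j by (rule absv_power_Suc_div_fact_le)
    also have "\<dots> = (absv z)\<^sup>2 / \<rho> * (absv z / \<rho>) ^ j"
      by (simp add: power2_eq_square)
    also have "\<dots> \<le> (absv z)\<^sup>2 / \<rho>"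
      using ratio_power_le_1[OF assms, of j] radius_pos by (intro mult_left_le) auto
    finally show ?thesis .
  qed
  from absv_padic_exp_diff_le[OF assms this, of 2] show ?thesis
    by (simp add: numeral_2_eq_2 diff_diff_eq)
qed

text \<open>The product of two truncated series runs over a square of indices, the truncated series
  of \<open>a + b\<close> over the triangle \<open>i + j < N\<close> inside it. Every leftover term
  has \<open>i + j \<ge> N\<close> and so is at most \<open>\<theta> ^ N\<close>.\<close>

lemma padic_exp_add:
  assumes a: "absv (a :: 'a) < \<rho>" and b: "absv b < \<rho>"
  shows "padic_exp (a + b) = padic_exp a * padic_exp b"
proof -
  \<comment> \<open>By the ultrametric inequality \<open>r\<close> bounds \<open>a + b\<close> as
    well, so one ratio \<open>\<theta>\<close> serves all three series.\<close>
  define r where "r = max (absv a) (absv b)"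
  define \<theta> where "\<theta> = r / \<rho>"
  define S where "S N z = (\<Sum>k<N. z ^ k / fact k)" for N and z :: 'a
  have r: "0 \<le> r" "r < \<rho>" using a b by (auto simp: r_def le_max_iff_disj)
  then have \<theta>: "0 \<le> \<theta>" "\<theta> < 1" using radius_pos by (auto simp: \<theta>_def)
  have zr: "absv z < \<rho>" "absv (z ^ k / fact k) \<le> \<theta> ^ k" if "absv z \<le> r" for z :: 'a and k
  proof -
    show z: "absv z < \<rho>" using that r by simp
    have "(absv z / \<rho>) ^ k \<le> \<theta> ^ k"
      unfolding \<theta>_def using that radius_pos by (intro power_mono divide_right_mono) auto
    with absv_exp_term_le[of z k] show "absv (z ^ k / fact k) \<le> \<theta> ^ k"
      by (rule order_trans)
  qed
  have le1: "\<theta> ^ k \<le> 1" for k using \<theta> by (simp add: power_le_one)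
  have mono: "\<theta> ^ k \<le> \<theta> ^ N" if "k \<ge> N" for k N using \<theta> that by (simp add: power_decreasing)
  have tail: "absv (padic_exp z - S N z) \<le> \<theta> ^ N" if z: "absv z \<le> r" for z :: 'a and N
    unfolding S_def by (rule absv_padic_exp_diff_le[OF zr(1)[OF z]]) (meson zr(2)[OF z] mono order_trans)
  have S1: "absv (S N z) \<le> 1" if "absv z \<le> r" for z :: 'a and N
    unfolding S_def using zr(2)[OF that] le1 by (intro absv_sum_le) (auto intro: order_trans)
  have E1: "absv (padic_exp z) \<le> 1" if "absv z \<le> r" for z :: 'a
    using tail[OF that, of 0] by (simp add: S_def)
  have ar: "absv a \<le> r" "absv b \<le> r" "absv (a + b) \<le> r"
    using absv_add_le_max[of a b] unfolding r_def by simp_all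
  have prod: "absv (S N a * S N b - S N (a + b)) \<le> \<theta> ^ N" for N
  proof -
    let ?g = "\<lambda>i j. (a ^ i / fact i) * (b ^ j / fact j)"
    have "S N (a + b) = (\<Sum>k<N. \<Sum>i\<le>k. ?g i (k - i))"
      unfolding S_def binomial_ring sum_divide_distrib
      by (intro sum.cong refl) (simp add: binomial_fact)
    also have "\<dots> = (\<Sum>(i,j)\<in>{(i,j). i + j < N}. ?g i j)"
      by (rule sum.triangle_reindex[symmetric])
    finally have T: "S N (a + b) = (\<Sum>(i,j)\<in>{(i,j). i + j < N}. ?g i j)" .
    have Q: "S N a * S N b = (\<Sum>(i,j)\<in>{..<N} \<times> {..<N}. ?g i j)"
      unfolding S_def by (simp add: sum_product sum.cartesian_product)
    have "{(i,j). i + j < N} \<subseteq> {..<N} \<times> {..<N}" by auto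
    then have "S N a * S N b - S N (a + b) = (\<Sum>(i,j)\<in>{..<N} \<times> {..<N} - {(i,j). i + j < N}. ?g i j)"
      unfolding T Q by (subst sum_diff) auto
    also have "absv \<dots> \<le> \<theta> ^ N"
    proof (rule absv_sum_le)
      fix ij assume "ij \<in> {..<N} \<times> {..<N} - {(i,j). i + j < N}"
      then obtain i j where ij: "ij = (i, j)" "i + j \<ge> N" by auto
      have "absv (?g i j) \<le> \<theta> ^ i * \<theta> ^ j"
        unfolding absv_mult using zr(2)[OF ar(1)] zr(2)[OF ar(2)] \<theta> by (intro mult_mono) auto
      also have "\<dots> \<le> \<theta> ^ N" using mono[OF ij(2)] by (simp add: power_add)
      finally show "absv (case ij of (i, j) \<Rightarrow> ?g i j) \<le> \<theta> ^ N" by (simp add: ij(1))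
    qed (use \<theta> in simp)
    finally show ?thesis .
  qed
  have "absv (padic_exp (a + b) - padic_exp a * padic_exp b) \<le> \<theta> ^ N" for N
  proof (rule absv_diff_trans[OF tail[OF ar(3)]])
    have "absv (padic_exp a * padic_exp b - S N a * S N b) \<le> \<theta> ^ N"
      by (intro absv_mult_diff_le tail E1 S1 ar)
    with prod[of N] show "absv (S N (a + b) - padic_exp a * padic_exp b) \<le> \<theta> ^ N"
      by (metis absv_diff_trans absv_minus_commute)
  qed
  then show ?thesis
    using eq_zero_if_absv_le_powers[OF \<theta>, of "padic_exp (a + b) - padic_exp a * padic_exp b" 1] by simp
qed

lemma padic_exp_of_nat_mult:
  assumes "absv (z :: 'a) < \<rho>"
  shows "padic_exp (of_nat n * z) = padic_exp z ^ n"
proof (induction n)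
  case 0
  \<comment> \<open>At \<open>z = 0\<close> the bound on \<open>padic_exp z - 1\<close> is 0, which
    gives \<open>padic_exp 0 = 1\<close>.\<close>
  show ?case
    using absv_padic_exp_minus_1_le[of 0] radius_pos by (simp add: order_antisym_conv)
next
  case (Suc n)
  have "absv (of_nat n * z) < \<rho>"
    using absv_of_nat_mult_le[of n z] assms by linarith
  with Suc assms show ?case
    by (simp add: distrib_right padic_exp_add)
qed


section \<open>Powers and the logarithm\<close>

lemma absv_fact_le_1: "absv (fact n :: 'a) \<le> 1"
  using absv_of_nat_le_1[of "fact n"] by simp

lemma absv_fact_pos: "0 < absv (fact n :: 'a)"
  by simp

lemma of_nat_choose_Suc_eq:
  "of_nat (Suc M choose Suc k) = (of_nat (Suc M) * of_nat (M choose k) / of_nat (Suc k) :: 'a)"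
  using arg_cong[OF Suc_times_binomial[of k M], of "of_nat :: nat \<Rightarrow> 'a"]
  unfolding of_nat_mult nonzero_eq_divide_eq[OF of_nat_neq_0] by (simp only: mult.commute)

text \<open>The generalized binomial coefficient of -1 over \<open>i\<close> is
  \<open>(- 1) ^ i\<close>, and \<open>M\<close> is close to -1 when \<open>Suc M\<close> is
  p-adically small. By Pascal's rule the deviation at \<open>Suc i\<close> is
  \<open>Suc M choose Suc i\<close> minus the deviation at \<open>i\<close>, and the former contains
  the factor \<open>Suc M\<close>.\<close>

lemma absv_binomial_minus_alternating_le:
  "absv (of_nat (M choose i) - (- 1) ^ i :: 'a) \<le> absv (of_nat (Suc M) :: 'a) / absv (fact i :: 'a)"
proof (induction i)
  case (Suc i)
  have fs: "absv (fact (Suc i) :: 'a) = absv (of_nat (Suc i) :: 'a) * absv (fact i :: 'a)"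
    by (simp only: fact_Suc absv_mult)
  have "absv (of_nat (Suc M choose Suc i) :: 'a)
      = absv (of_nat (Suc M) :: 'a) * absv (of_nat (M choose i) :: 'a) / absv (of_nat (Suc i) :: 'a)"
    by (simp only: of_nat_choose_Suc_eq absv_divide absv_mult)
  also have "\<dots> \<le> absv (of_nat (Suc M) :: 'a) / absv (of_nat (Suc i) :: 'a)"
    by (intro divide_right_mono mult_left_le absv_of_nat_le_1 absv_nonneg)
  also have "\<dots> \<le> absv (of_nat (Suc M) :: 'a) / absv (fact (Suc i) :: 'a)"
    unfolding fs
    by (intro divide_left_mono mult_left_le absv_fact_le_1 absv_nonneg mult_pos_pos absv_fact_pos)
      (simp_all del: of_nat_Suc)
  finally have 1: "absv (of_nat (Suc M choose Suc i) :: 'a)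
      \<le> absv (of_nat (Suc M) :: 'a) / absv (fact (Suc i) :: 'a)" .
  have "absv (fact (Suc i) :: 'a) \<le> absv (fact i :: 'a)"
    unfolding fs by (intro mult_left_le_one_le absv_nonneg absv_of_nat_le_1)
  then have "absv (of_nat (Suc M) :: 'a) / absv (fact i :: 'a)
      \<le> absv (of_nat (Suc M) :: 'a) / absv (fact (Suc i) :: 'a)"
    by (intro divide_left_mono absv_nonneg mult_pos_pos absv_fact_pos)
  with Suc.IH have 2: "absv (of_nat (M choose i) - (- 1) ^ i :: 'a)
      \<le> absv (of_nat (Suc M) :: 'a) / absv (fact (Suc i) :: 'a)"
    by (rule order_trans)
  have "of_nat (M choose Suc i) - (- 1) ^ Suc i
      = (of_nat (Suc M choose Suc i) - (of_nat (M choose i) - (- 1) ^ i) :: 'a)"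
    by simp
  with absv_diff_le[OF 1 2] show ?case
    by (simp only:)
qed simp

text \<open>Expand in powers of \<open>u - 1\<close> and pull \<open>Suc M\<close> out of each
  coefficient. The remaining sum is a truncated logarithm with \<open>M choose k\<close> in place of
  \<open>(- 1) ^ k\<close>.\<close>

lemma power_Suc_minus_1_eq:
  "u ^ Suc M - 1 =
    of_nat (Suc M) * (\<Sum>k<Suc M. of_nat (M choose k) * ((u - 1) ^ Suc k / of_nat (Suc k)) :: 'a)"
proof -
  have "u ^ Suc M = ((u - 1) + 1) ^ Suc M"
    by simp
  also have "\<dots> = (\<Sum>k\<le>Suc M. of_nat (Suc M choose k) * (u - 1) ^ k)"
    unfolding binomial_ring by simp
  also have "\<dots> = 1 + (\<Sum>k\<le>M. of_nat (Suc M choose Suc k) * (u - 1) ^ Suc k)"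
    unfolding sum.atMost_Suc_shift by simp
  also have "(\<Sum>k\<le>M. of_nat (Suc M choose Suc k) * (u - 1) ^ Suc k)
    = of_nat (Suc M) * (\<Sum>k<Suc M. of_nat (M choose k) * ((u - 1) ^ Suc k / of_nat (Suc k)))"
    unfolding sum_distrib_left lessThan_Suc_atMost
    by (intro sum.cong refl) (simp add: of_nat_choose_Suc_eq del: of_nat_Suc binomial_Suc_Suc)
  finally show ?thesis
    by simp
qed

text \<open>The term is the exponential term multiplied by the integer \<open>fact k\<close>, which
  cannot enlarge it.\<close>

lemma absv_log_term_le:
  "absv (t ^ Suc k / of_nat (Suc k) :: 'a) \<le> absv t * (absv t / \<rho>) ^ k"
proof -
  have "t ^ Suc k / of_nat (Suc k) = fact k * (t ^ Suc k / fact (Suc k))"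
    by (simp del: power_Suc)
  then have "absv (t ^ Suc k / of_nat (Suc k)) \<le> absv (t ^ Suc k / fact (Suc k))"
    using absv_fact_le_1[of k] by (simp only: absv_mult mult_left_le_one_le absv_nonneg)
  also have "\<dots> \<le> absv t * (absv t / \<rho>) ^ k"
    by (rule absv_power_Suc_div_fact_le)
  finally show ?thesis .
qed

lemma mult_ratio_power_le:
  assumes "absv (t :: 'a) < \<rho>"
  shows "absv t * (absv t / \<rho>) ^ k \<le> absv t"
  by (intro mult_left_le ratio_power_le_1 assms absv_nonneg)

lemma absv_padic_log_diff_le:
  assumes "absv (u - 1 :: 'a) < \<rho>"
    and "\<And>k. k \<ge> N \<Longrightarrow> absv ((u - 1) ^ Suc k / of_nat (Suc k)) \<le> B"
  shows "absv (padic_log u - (\<Sum>k<N. (- 1) ^ k * (u - 1) ^ Suc k / of_nat (Suc k))) \<le> B"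
  unfolding padic_log_def
proof (rule absv_suminf_diff_le)
  have eq: "absv ((- 1) ^ k * (u - 1) ^ Suc k / of_nat (Suc k)) = absv ((u - 1) ^ Suc k / of_nat (Suc k))" for k
    unfolding times_divide_eq_right[symmetric] absv_mult absv_power[of "- 1"] by simp
  have le: "absv t * c \<le> c" if "absv (t :: 'a) < \<rho>" "0 \<le> c" for t c
    using that radius_le_1 by (intro mult_left_le_one_le) auto
  show "(\<lambda>k. absv ((- 1) ^ k * (u - 1) ^ Suc k / of_nat (Suc k))) \<longlonglongrightarrow> 0"
    unfolding eq
    by (rule absv_le_geometric_tendsto_0[OF assms(1)],
        rule order_trans[OF absv_log_term_le le[OF assms(1)]])
      (use radius_pos in simp)
  show "absv ((- 1) ^ k * (u - 1) ^ Suc k / of_nat (Suc k)) \<le> B" if "k \<ge> N" for k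
    unfolding eq by (rule assms(2)[OF that])
qed

lemma absv_padic_log_le:
  assumes "absv (u - 1 :: 'a) < \<rho>"
  shows "absv (padic_log u) \<le> absv (u - 1)"
proof -
  have "absv ((u - 1) ^ Suc k / of_nat (Suc k)) \<le> absv (u - 1)" for k
    using absv_log_term_le mult_ratio_power_le[OF assms] by (rule order_trans)
  from absv_padic_log_diff_le[OF assms this, of 0] show ?thesis by simp
qed

text \<open>The quantitative form of \<open>log u = lim (u ^ N - 1) / N\<close> for \<open>N\<close> tending \<open>p\<close>-adically to \<open>0\<close>.\<close>

lemma absv_power_minus_log_le:
  assumes u: "absv (u - 1 :: 'a) < \<rho>"
  shows "absv (u ^ N - 1 - of_nat N * padic_log u) \<le> (absv (of_nat N :: 'a))\<^sup>2"
proof (cases N)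
  case (Suc M)
  define t where "t = u - 1"
  define T where "T k = t ^ Suc k / of_nat (Suc k)" for k
  define B where "B = absv (of_nat (Suc M) :: 'a)"
  have t: "absv t < \<rho>" using u by (simp add: t_def)
  have B: "0 \<le> B" by (simp add: B_def)
  have term_le: "absv (of_nat (M choose k) * T k - (- 1) ^ k * T k) \<le> B" for k
  proof -
    have "absv (of_nat (M choose k) * T k - (- 1) ^ k * T k)
        = absv (of_nat (M choose k) - (- 1) ^ k :: 'a) * absv (T k)"
      by (simp only: left_diff_distrib[symmetric] absv_mult)
    also have "\<dots> \<le> absv (of_nat (Suc M) :: 'a) / absv (fact k :: 'a) * absv (T k)"
      by (intro mult_right_mono absv_binomial_minus_alternating_le absv_nonneg)
    \<comment> \<open>The \<open>fact k\<close> in the denominator turns the logarithmic term into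
      an exponential one, which is at most 1 on the disc.\<close>
    also have "\<dots> = absv (of_nat (Suc M) :: 'a) * absv (t ^ Suc k / fact (Suc k))"
      unfolding T_def absv_divide fact_Suc absv_mult by (simp del: of_nat_Suc)
    also have "\<dots> \<le> B"
      unfolding B_def
      using absv_power_Suc_div_fact_le[of t k] mult_ratio_power_le[OF t, of k] t radius_le_1
      by (intro mult_left_le absv_nonneg) linarith
    finally show ?thesis .
  qed
  \<comment> \<open>Here \<open>M choose k\<close> vanishes, so \<open>term_le\<close> also bounds
    the tail of the logarithm.\<close>
  have T_le: "absv (T k) \<le> B" if "k \<ge> Suc M" for k
  proof -
    have "absv (of_nat (M choose k) * T k - (- 1) ^ k * T k) = absv (T k)"
      using that by (simp add: binomial_eq_0 absv_mult absv_power)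
    with term_le[of k] show ?thesis by simp
  qed
  let ?S = "\<Sum>k<Suc M. of_nat (M choose k) * T k"
  have "absv (?S - (\<Sum>k<Suc M. (- 1) ^ k * T k)) \<le> B"
    unfolding sum_subtractf[symmetric] by (intro absv_sum_le B term_le)
  moreover have "absv ((\<Sum>k<Suc M. (- 1) ^ k * T k) - padic_log u) \<le> B"
    using absv_padic_log_diff_le[OF u T_le[unfolded T_def t_def]]
    by (subst absv_minus_commute) (simp only: T_def t_def times_divide_eq_right)
  ultimately have "absv (?S - padic_log u) \<le> B"
    by (rule absv_diff_trans)
  \<comment> \<open>The factor \<open>Suc M\<close> in front of the expansion supplies the second
    factor of the square.\<close>
  then have "absv (of_nat (Suc M) :: 'a) * absv (?S - padic_log u) \<le> absv (of_nat (Suc M) :: 'a) * B"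
    by (intro mult_left_mono absv_nonneg)
  then show ?thesis
    unfolding Suc power_Suc_minus_1_eq absv_mult[symmetric] right_diff_distrib
    by (simp only: T_def t_def B_def power2_eq_square mult.assoc)
qed simp

text \<open>After division by \<open>N\<close> the expansion starts with \<open>u - 1\<close>, and
  every later term is smaller by a factor \<open>absv (u - 1) / \<rho> < 1\<close>, so the first one
  dominates. In particular \<open>u\<close> is not a root of unity unless
  \<open>u = 1\<close>.\<close>

lemma absv_power_minus_1:
  assumes u: "absv (u - 1 :: 'a) < \<rho>"
  shows "absv (u ^ N - 1) = absv (of_nat N :: 'a) * absv (u - 1)"
proof (cases "u = 1 \<or> N = 0")
  case False
  then obtain M where N: "N = Suc M" by (cases N) auto
  define t where "t = u - 1"
  define T where "T k = t ^ Suc k / of_nat (Suc k)" for k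
  have t: "absv t < \<rho>" "0 < absv t" using u False by (simp_all add: t_def)
  define B where "B = absv t * (absv t / \<rho>)"
  have B: "0 \<le> B" "B < absv t"
    using t radius_pos by (auto simp: B_def field_simps)
  have "absv (of_nat (M choose Suc k) * T (Suc k)) \<le> B" for k
  proof -
    have "absv (T (Suc k)) \<le> absv t * (absv t / \<rho>) * (absv t / \<rho>) ^ k"
      unfolding T_def using absv_log_term_le[of t "Suc k"] by (simp only: power_Suc mult.assoc)
    also have "\<dots> \<le> B"
      unfolding B_def using B(1)[unfolded B_def] by (intro mult_left_le ratio_power_le_1 t)
    finally show ?thesis
      using absv_of_nat_mult_le[of "M choose Suc k" "T (Suc k)"] by linarith
  qed
  then have "absv (\<Sum>k<M. of_nat (M choose Suc k) * T (Suc k)) \<le> B"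
    by (intro absv_sum_le B)
  moreover have "(\<Sum>k<Suc M. of_nat (M choose k) * T k) = t + (\<Sum>k<M. of_nat (M choose Suc k) * T (Suc k))"
    unfolding sum.lessThan_Suc_shift by (simp add: T_def)
  ultimately have "absv ((\<Sum>k<Suc M. of_nat (M choose k) * T k) - t) < absv t"
    using B by simp
  then have "absv (\<Sum>k<Suc M. of_nat (M choose k) * T k) = absv t"
    by (rule absv_eq_of_close)
  then show ?thesis
    unfolding N power_Suc_minus_1_eq by (simp only: absv_mult T_def t_def)
qed auto

lemma power_neq_1:
  assumes "absv (u - 1 :: 'a) < \<rho>" "u \<noteq> 1" "N > 0"
  shows "u ^ N \<noteq> 1"
  using absv_power_minus_1[OF assms(1), of N] assms(2,3) by auto

lemma absv_power_minus_1_less: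
  assumes "absv (u - 1 :: 'a) < \<rho>"
  shows "absv (u ^ N - 1) < \<rho>"
  using absv_of_nat_mult_le[of N "u - 1"] assms
  unfolding absv_power_minus_1[OF assms] absv_mult by linarith

text \<open>Cancelling one factor leaves \<open>absv x \<le> (1 / p) ^ k\<close> for all
  \<open>k\<close>; thus knowing \<open>N x\<close> up to the square of \<open>N\<close> determines
  \<open>x\<close>.\<close>

lemma eq_zero_if_absv_prime_power_le:
  assumes "\<And>k. absv (of_nat (p ^ k) :: 'a) * absv x \<le> (absv (of_nat (p ^ k) :: 'a))\<^sup>2"
  shows "(x :: 'a) = 0"
proof (rule eq_zero_if_absv_le_powers[of "1 / real p" _ 1])
  show "0 \<le> 1 / real p" "1 / real p < 1"
    using prime_gt_1_nat[OF prime] by auto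
  show "absv x \<le> 1 * (1 / real p) ^ k" for k
    using assms[of k] prime_gt_0_nat[OF prime]
    unfolding absv_of_nat_prime_power power2_eq_square by (subst (asm) mult_le_cancel_left_pos) auto
qed

text \<open>The number \<open>u ^ (n * N)\<close> is approximated twice, as the \<open>N\<close>-th
  power of \<open>u ^ n\<close> and as the \<open>n * N\<close>-th power of \<open>u\<close>; for
  \<open>N = p ^ k\<close> the linear terms must agree.\<close>

lemma padic_log_power:
  assumes u: "absv (u - 1 :: 'a) < \<rho>"
  shows "padic_log (u ^ n) = of_nat n * padic_log u"
proof -
  have "padic_log (u ^ n) - of_nat n * padic_log u = 0"
  proof (rule eq_zero_if_absv_prime_power_le)
    fix k
    define N where "N = p ^ k"
    have un: "absv (u ^ n - 1) < \<rho>" by (rule absv_power_minus_1_less[OF u])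
    have "absv (u ^ (n * N) - 1 - of_nat N * padic_log (u ^ n)) \<le> (absv (of_nat N :: 'a))\<^sup>2"
      using absv_power_minus_log_le[OF un, of N] unfolding power_mult .
    moreover have "absv (u ^ (n * N) - 1 - of_nat (n * N) * padic_log u) \<le> (absv (of_nat N :: 'a))\<^sup>2"
    proof -
      have "absv (of_nat (n * N) :: 'a) \<le> absv (of_nat N :: 'a)"
        unfolding of_nat_mult by (rule absv_of_nat_mult_le)
      then have "(absv (of_nat (n * N) :: 'a))\<^sup>2 \<le> (absv (of_nat N :: 'a))\<^sup>2"
        by (intro power_mono absv_nonneg)
      with absv_power_minus_log_le[OF u, of "n * N"] show ?thesis by (rule order_trans)
    qed
    ultimately have "absv ((u ^ (n * N) - 1 - of_nat (n * N) * padic_log u)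
        - (u ^ (n * N) - 1 - of_nat N * padic_log (u ^ n))) \<le> (absv (of_nat N :: 'a))\<^sup>2"
      by (rule absv_diff_le[rotated])
    also have "(u ^ (n * N) - 1 - of_nat (n * N) * padic_log u)
        - (u ^ (n * N) - 1 - of_nat N * padic_log (u ^ n))
        = of_nat N * (padic_log (u ^ n) - of_nat n * padic_log u)"
      by (simp add: algebra_simps)
    finally show "absv (of_nat (p ^ k) :: 'a) * absv (padic_log (u ^ n) - of_nat n * padic_log u)
        \<le> (absv (of_nat (p ^ k) :: 'a))\<^sup>2"
      unfolding absv_mult N_def .
  qed
  then show ?thesis by simp
qed

text \<open>
  With \<open>g = exp (log u) / u\<close> and \<open>N = p ^ k\<close>, both \<open>exp (N log u)\<close> and \<open>u ^ N\<close> are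
  \<open>1 + N log u\<close> up to \<open>O(N\<^sup>2)\<close>, while \<open>g ^ N - 1\<close> has absolute value \<open>\<bar>N\<bar> \<bar>g - 1\<bar>\<close>.
\<close>

lemma padic_exp_log:
  assumes u: "absv (u - 1 :: 'a) < \<rho>"
  shows "padic_exp (padic_log u) = u"
proof -
  define L where "L = padic_log u"
  define g where "g = padic_exp L / u"
  have L: "absv L \<le> absv (u - 1)" "absv L < \<rho>"
    using absv_padic_log_le[OF u] u by (auto simp: L_def)
  have "absv u = absv (1 :: 'a)"
    by (rule absv_eq_of_close) (use u radius_le_1 in simp)
  then have u1: "absv u = 1" "u \<noteq> 0" by auto
  have "absv (padic_exp L - 1) \<le> absv (u - 1)"
    using absv_padic_exp_minus_1_le[OF L(2)] L(1) by (rule order_trans)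
  then have "absv (padic_exp L - u) \<le> absv (u - 1)"
    by (rule absv_diff_trans) (simp add: absv_minus_commute)
  moreover have "g - 1 = (padic_exp L - u) / u"
    using u1 by (simp add: g_def diff_divide_distrib)
  ultimately have g: "absv (g - 1) < \<rho>"
    using u u1 by (simp add: absv_divide)
  have "g - 1 = 0"
  proof (rule eq_zero_if_absv_prime_power_le)
    fix k
    define N where "N = p ^ k"
    define NL where "NL = of_nat N * L"
    have NL_le: "absv NL \<le> absv (of_nat N :: 'a) * \<rho>"
      unfolding NL_def absv_mult using L by (intro mult_left_mono) auto
    have NL: "absv NL < \<rho>"
      using absv_of_nat_mult_le[of N L] L(2) unfolding NL_def by linarith
    have "absv (padic_exp NL - 1 - NL) \<le> (absv NL)\<^sup>2 / \<rho>"
      by (rule absv_padic_exp_minus_linear_le[OF NL])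
    also have "\<dots> \<le> (absv (of_nat N :: 'a) * \<rho>)\<^sup>2 / \<rho>"
      using NL_le radius_pos by (intro divide_right_mono power_mono) auto
    also have "\<dots> = (absv (of_nat N :: 'a))\<^sup>2 * \<rho>"
      using radius_pos by (simp add: power2_eq_square)
    also have "\<dots> \<le> (absv (of_nat N :: 'a))\<^sup>2"
      using radius_le_1 radius_pos by (intro mult_left_le) auto
    finally have 1: "absv (padic_exp NL - 1 - NL) \<le> (absv (of_nat N :: 'a))\<^sup>2" .
    have "absv (u ^ N - 1 - NL) \<le> (absv (of_nat N :: 'a))\<^sup>2"
      unfolding NL_def L_def by (rule absv_power_minus_log_le[OF u])
    then have "absv ((padic_exp NL - 1 - NL) - (u ^ N - 1 - NL)) \<le> (absv (of_nat N :: 'a))\<^sup>2"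
      by (intro absv_diff_le[OF 1])
    then have "absv (padic_exp NL - u ^ N) \<le> (absv (of_nat N :: 'a))\<^sup>2"
      by simp
    moreover have "padic_exp NL = padic_exp L ^ N"
      unfolding NL_def by (rule padic_exp_of_nat_mult[OF L(2)])
    moreover have "g ^ N - 1 = (padic_exp L ^ N - u ^ N) / u ^ N"
      using u1 by (simp add: g_def power_divide diff_divide_distrib)
    ultimately have "absv (g ^ N - 1) \<le> (absv (of_nat N :: 'a))\<^sup>2"
      using u1 by (simp add: absv_divide absv_power)
    then show "absv (of_nat (p ^ k) :: 'a) * absv (g - 1) \<le> (absv (of_nat (p ^ k) :: 'a))\<^sup>2"
      unfolding absv_power_minus_1[OF g] N_def .
  qed
  then show ?thesis
    using u1 by (simp add: g_def L_def)
qed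

section \<open>Powers with p-adic exponents\<close>

lemma padic_power_of_nat:
  assumes "absv (u - 1 :: 'a) < \<rho>"
  shows "padic_power u (of_nat n) = u ^ n"
  unfolding padic_power_def
  using padic_exp_of_nat_mult[of "padic_log u" n] absv_padic_log_le[OF assms] assms
  by (simp add: padic_exp_log)

lemma padic_power_of_nat_mult:
  assumes "absv (u - 1 :: 'a) < \<rho>" "absv z \<le> 1"
  shows "padic_power u (of_nat n * z) = padic_power u z ^ n"
proof -
  have "absv (z * padic_log u) \<le> absv (padic_log u)"
    unfolding absv_mult by (intro mult_left_le_one_le absv_nonneg assms)
  then have "absv (z * padic_log u) < \<rho>"
    using absv_padic_log_le[OF assms(1)] assms(1) by linarith
  from padic_exp_of_nat_mult[OF this, of n] show ?thesis
    by (simp add: padic_power_def mult.assoc)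
qed

text \<open>The logarithm turns the \<open>n\<close>-th power into a factor \<open>n\<close>, and
  the exponential turns it back. The bound on \<open>z\<close> keeps \<open>z * padic_log u\<close>
  inside the disc.\<close>

lemma padic_power_power:
  assumes "absv (u - 1 :: 'a) < \<rho>" "absv z \<le> 1"
  shows "padic_power (u ^ n) z = padic_power u z ^ n"
  using padic_power_of_nat_mult[OF assms, of n]
  by (simp add: padic_power_def padic_log_power[OF assms(1)] ac_simps)

end

subsection \<open>Carlitz numbers and the closed form\<close>

text \<open>Choosing \<open>l\<close> and then \<open>i\<close> equals choosing \<open>i\<close>
  first and \<open>l - i\<close> from the rest; the remaining sum is
  \<open>(B + (1 - B)) ^ (m - i) = 1\<close>.\<close>

lemma sum_choose_mult_choose:
  fixes B :: "'a::comm_ring_1"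
  shows "(\<Sum>l\<le>m. of_nat (m choose l) * of_nat (l choose i) * B ^ l * (1 - B) ^ (m - l))
    = of_nat (m choose i) * B ^ i"
proof (cases "i \<le> m")
  case True
  let ?f = "\<lambda>l. of_nat (m choose l) * of_nat (l choose i) * B ^ l * (1 - B) ^ (m - l)"
  have "(\<Sum>l\<le>m. ?f l) = (\<Sum>l\<in>{i..m}. ?f l)"
    by (rule sum.mono_neutral_right) (auto simp: not_le binomial_eq_0)
  also have "\<dots> = (\<Sum>k\<le>m - i. ?f (i + k))"
    by (rule sum.reindex_bij_witness[of _ "\<lambda>k. i + k" "\<lambda>l. l - i"]) (use True in auto)
  also have "\<dots> = (\<Sum>k\<le>m - i. of_nat (m choose i) * B ^ i *
      (of_nat ((m - i) choose k) * B ^ k * (1 - B) ^ (m - i - k)))"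
  proof (rule sum.cong[OF refl])
    fix k assume "k \<in> {..m - i}"
    then have "(m choose (i + k)) * ((i + k) choose i) = (m choose i) * ((m - i) choose k)"
      using choose_mult[of i "i + k" m] True by simp
    then have "of_nat (m choose (i + k)) * of_nat ((i + k) choose i)
        = (of_nat (m choose i) * of_nat ((m - i) choose k) :: 'a)"
      by (metis of_nat_mult)
    then show "?f (i + k) = of_nat (m choose i) * B ^ i *
        (of_nat ((m - i) choose k) * B ^ k * (1 - B) ^ (m - i - k))"
      by (simp add: power_add mult_ac)
  qed
  also have "\<dots> = of_nat (m choose i) * B ^ i"
    unfolding sum_distrib_left[symmetric] binomial_ring[symmetric] by simp
  finally show ?thesis .
next
  case False
  then show ?thesis
    by (auto intro!: sum.neutral simp: not_le binomial_eq_0)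
qed

text \<open>Averaging with Bernstein weights multiplies the transformed sequence by
  \<open>B ^ i\<close>. It serves with \<open>B = Q\<close> for the recurrence, with the power of
  \<open>Q\<close> to \<open>a\<close> for the polynomials, and with \<open>Z k\<close> for the sum
  over \<open>l\<close> in \<open>C_sum\<close>.\<close>

lemma sum_bernstein_binomial_transform:
  fixes B :: "'a::comm_ring_1"
  shows "(\<Sum>l\<le>m. of_nat (m choose l) * B ^ l * (1 - B) ^ (m - l)
        * (\<Sum>i\<le>l. of_nat (l choose i) * (- 1) ^ i * y i))
    = (\<Sum>i\<le>m. of_nat (m choose i) * (- 1) ^ i * B ^ i * y i)"
proof -
  have "(\<Sum>i\<le>l. of_nat (l choose i) * (- 1) ^ i * y i) = (\<Sum>i\<le>m. of_nat (l choose i) * (- 1) ^ i * y i)"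
    if "l \<le> m" for l
    by (rule sum.mono_neutral_left) (use that in \<open>auto simp: not_le binomial_eq_0\<close>)
  then have "(\<Sum>l\<le>m. of_nat (m choose l) * B ^ l * (1 - B) ^ (m - l)
        * (\<Sum>i\<le>l. of_nat (l choose i) * (- 1) ^ i * y i))
    = (\<Sum>l\<le>m. \<Sum>i\<le>m. (- 1) ^ i * y i *
        (of_nat (m choose l) * of_nat (l choose i) * B ^ l * (1 - B) ^ (m - l)))"
    by (intro sum.cong refl) (simp add: sum_distrib_left mult_ac)
  also have "\<dots> = (\<Sum>i\<le>m. (- 1) ^ i * y i *
        (\<Sum>l\<le>m. of_nat (m choose l) * of_nat (l choose i) * B ^ l * (1 - B) ^ (m - l)))"
    unfolding sum_distrib_left by (rule sum.swap)
  also have "\<dots> = (\<Sum>i\<le>m. of_nat (m choose i) * (- 1) ^ i * B ^ i * y i)"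
    unfolding sum_choose_mult_choose by (simp add: mult_ac)
  finally show ?thesis .
qed

section \<open>Closed forms for Carlitz numbers and the multiple sum\<close>

text \<open>This is \<open>Suc i\<close> divided by its \<open>Q\<close>-analogue; multiplication by
  \<open>Q ^ Suc i - 1\<close> makes it linear in \<open>i\<close>.\<close>

definition carlitz_coeff :: "'a::field \<Rightarrow> nat \<Rightarrow> 'a" where
  "carlitz_coeff Q i = of_nat (Suc i) * (1 - Q) / (1 - Q ^ Suc i)"

text \<open>By uniqueness it suffices to check the recurrence. Its left side becomes the alternating
  transform of \<open>(Q ^ Suc i - 1) * carlitz_coeff Q i\<close>, a linear function of
  \<open>i\<close>, and such a transform vanishes for \<open>r > 1\<close>.\<close>

lemma carlitz_number_eq:
  fixes Q :: "'a::field"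
  assumes Q: "\<And>r. r > 0 \<Longrightarrow> Q ^ r \<noteq> 1"
  shows "carlitz_number Q l
    = (\<Sum>i\<le>l. of_nat (l choose i) * (- 1) ^ i * carlitz_coeff Q i) / (1 - Q) ^ l"
proof -
  define s where "s l = (\<Sum>i\<le>l. of_nat (l choose i) * (- 1) ^ i * carlitz_coeff Q i)" for l
  have D: "1 - Q \<noteq> 0" using Q[of 1] by simp
  have coeff: "(Q ^ Suc i - 1) * carlitz_coeff Q i = (Q - 1) * of_nat (Suc i)" for i
    using Q[of "Suc i"] by (simp add: carlitz_coeff_def divide_simps del: power_Suc of_nat_Suc)
      (simp add: algebra_simps)
  have "carlitz_recurrence Q (\<lambda>l. s l / (1 - Q) ^ l)"
    unfolding carlitz_recurrence_def
  proof (intro conjI allI impI)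
    show "s 0 / (1 - Q) ^ 0 = 1"
      using D by (simp add: s_def carlitz_coeff_def)
    fix r :: nat assume r: "r \<ge> 1"
    have "(\<Sum>l\<le>r. of_nat (r choose l) * Q ^ l * (s l / (1 - Q) ^ l))
        = (\<Sum>l\<le>r. of_nat (r choose l) * Q ^ l * (1 - Q) ^ (r - l) * s l) / (1 - Q) ^ r"
      unfolding sum_divide_distrib
      by (intro sum.cong refl) (use D in \<open>simp add: power_diff\<close>)
    also have "\<dots> = (\<Sum>i\<le>r. of_nat (r choose i) * (- 1) ^ i * Q ^ i * carlitz_coeff Q i) / (1 - Q) ^ r"
      unfolding s_def sum_bernstein_binomial_transform ..
    finally have "Q * (\<Sum>l\<le>r. of_nat (r choose l) * Q ^ l * (s l / (1 - Q) ^ l)) - s r / (1 - Q) ^ r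
        = (\<Sum>i\<le>r. of_nat (r choose i) * (- 1) ^ i * ((Q ^ Suc i - 1) * carlitz_coeff Q i)) / (1 - Q) ^ r"
      unfolding s_def
      by (simp add: sum_distrib_left diff_divide_distrib[symmetric] sum_subtractf[symmetric] algebra_simps)
    also have "\<dots> = (\<Sum>i\<le>r. of_nat (r choose i) * (- 1) ^ i * ((Q - 1) * of_nat (Suc i))) / (1 - Q) ^ r"
      by (simp only: coeff)
    also have "(\<Sum>i\<le>r. of_nat (r choose i) * (- 1) ^ i * ((Q - 1) * of_nat (Suc i)))
        = (Q - 1) * ((\<Sum>i\<le>r. (- 1) ^ i * of_nat (r choose i)) + (\<Sum>i\<le>r. (- 1) ^ i * of_nat i * of_nat (r choose i)))"
      by (simp add: sum_distrib_left sum.distrib[symmetric] algebra_simps)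
    \<comment> \<open>For \<open>r = 1\<close> the first alternating sum is 0 and the second is -1,
      so the value is \<open>- (Q - 1) / (1 - Q) = 1\<close>.\<close>
    also have "\<dots> / (1 - Q) ^ r = (if r = 1 then 1 else 0)"
      using r D choose_alternating_linear_sum[of r, where 'a = 'a]
      by (auto simp: choose_alternating_sum divide_simps)
    finally show "Q * (\<Sum>l\<le>r. of_nat (r choose l) * Q ^ l * (s l / (1 - Q) ^ l)) - s r / (1 - Q) ^ r
        = (if r = 1 then 1 else 0)" .
  qed
  then have "carlitz_number Q = (\<lambda>l. s l / (1 - Q) ^ l)"
    unfolding carlitz_number_def by (intro the1_equality carlitz_recurrence_ex1[OF Q])
  then show ?thesis
    by (simp add: s_def)
qed

text \<open>The exponent is additive in the \<open>k j\<close>, so the sum over the box is a product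
  of geometric sums. All numerators agree because the product without \<open>v j\<close>, times
  \<open>v j\<close>, is the full product.\<close>

lemma sum_power_T_exponent:
  fixes s :: "'a::field"
  assumes v: "\<And>j. j \<in> {1..d} \<Longrightarrow> s ^ (\<Prod>i\<in>{1..d} - {j}. v i) \<noteq> 1"
  shows "(\<Sum>k\<in>PiE {1..d} (\<lambda>j. {..<v j}). s ^ T_exponent d v k)
    = (\<Prod>j=1..d. (1 - s ^ (\<Prod>i=1..d. v i)) / (1 - s ^ (\<Prod>i\<in>{1..d} - {j}. v i)))"
proof -
  have "(\<Sum>k\<in>PiE {1..d} (\<lambda>j. {..<v j}). s ^ T_exponent d v k)
      = (\<Sum>k\<in>PiE {1..d} (\<lambda>j. {..<v j}). \<Prod>j=1..d. (s ^ (\<Prod>i\<in>{1..d} - {j}. v i)) ^ k j)"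
    by (simp add: T_exponent_def power_sum power_mult)
  also have "\<dots> = (\<Prod>j=1..d. \<Sum>c<v j. (s ^ (\<Prod>i\<in>{1..d} - {j}. v i)) ^ c)"
    by (rule prod_sum_PiE[symmetric]) auto
  also have "\<dots> = (\<Prod>j=1..d. (1 - s ^ (\<Prod>i=1..d. v i)) / (1 - s ^ (\<Prod>i\<in>{1..d} - {j}. v i)))"
  proof (rule prod.cong[OF refl])
    fix j assume j: "j \<in> {1..d}"
    have "(\<Prod>i=1..d. v i) = (\<Prod>i\<in>{1..d} - {j}. v i) * v j"
      using j by (subst prod.remove[of _ j]) auto
    then have "1 - s ^ (\<Prod>i=1..d. v i) = 1 - (s ^ (\<Prod>i\<in>{1..d} - {j}. v i)) ^ v j"
      by (simp add: power_mult)
    then show "(\<Sum>c<v j. (s ^ (\<Prod>i\<in>{1..d} - {j}. v i)) ^ c)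
        = (1 - s ^ (\<Prod>i=1..d. v i)) / (1 - s ^ (\<Prod>i\<in>{1..d} - {j}. v i))"
      using v[OF j] by (simp add: sum_gp_strict)
  qed
  finally show ?thesis .
qed

section \<open>The symmetric form of \<open>C_sum\<close>\<close>

context padic_complex
begin

lemma q_bracket_of_nat:
  assumes "absv (Q - 1 :: 'a) < \<rho>"
  shows "q_bracket Q (of_nat k) = (1 - Q ^ k) / (1 - Q)"
  by (simp add: q_bracket_def padic_power_of_nat[OF assms])

text \<open>As \<open>q_bracket Q a = (1 - P) / (1 - Q)\<close>, the definition is a Bernstein sum
  at \<open>P\<close> of the transform giving the Carlitz numbers.\<close>

lemma carlitz_poly_eq:
  assumes Q: "absv (Q - 1 :: 'a) < \<rho>" "Q \<noteq> 1" and a: "absv a \<le> 1"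
  shows "carlitz_poly r Q a
    = (\<Sum>i\<le>r. of_nat (r choose i) * (- 1) ^ i * (padic_power Q a ^ i * carlitz_coeff Q i)) / (1 - Q) ^ r"
proof -
  define P where "P = padic_power Q a"
  have "carlitz_poly r Q a = (\<Sum>l\<le>r. of_nat (r choose l) * P ^ l * (1 - P) ^ (r - l)
      * (\<Sum>i\<le>l. of_nat (l choose i) * (- 1) ^ i * carlitz_coeff Q i)) / (1 - Q) ^ r"
    unfolding carlitz_poly_def sum_divide_distrib
  proof (intro sum.cong refl)
    fix l assume "l \<in> {..r}"
    then have "(1 - Q) ^ r = (1 - Q) ^ (r - l) * (1 - Q) ^ l"
      by (simp add: power_add[symmetric])
    then show "of_nat (r choose l) * padic_power Q (of_nat l * a) * q_bracket Q a ^ (r - l) * carlitz_number Q l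
        = of_nat (r choose l) * P ^ l * (1 - P) ^ (r - l)
          * (\<Sum>i\<le>l. of_nat (l choose i) * (- 1) ^ i * carlitz_coeff Q i) / (1 - Q) ^ r"
      by (simp add: carlitz_number_eq power_neq_1[OF Q] padic_power_of_nat_mult[OF Q(1) a]
          q_bracket_def P_def power_divide)
  qed
  also have "\<dots> = (\<Sum>i\<le>r. of_nat (r choose i) * (- 1) ^ i * P ^ i * carlitz_coeff Q i) / (1 - Q) ^ r"
    unfolding sum_bernstein_binomial_transform ..
  finally show ?thesis
    by (simp add: P_def mult.assoc)
qed

lemma C_sum_eq:
  fixes q x :: 'a and m n :: nat and w \<sigma> :: "nat \<Rightarrow> nat"
  defines "W \<equiv> \<Prod>j=1..n. w (\<sigma> j)"
  assumes q: "absv (q - 1) < \<rho>" "q \<noteq> 1" and x: "absv x \<le> 1"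
    and n: "n \<ge> 1" and w: "\<And>j. j \<in> {1..n} \<Longrightarrow> w (\<sigma> j) > 0"
  shows "C_sum m n w q x \<sigma> = (\<Sum>i\<le>m. of_nat (m choose i) * (- 1) ^ i * padic_power q x ^ (W * i)
      * of_nat (Suc i) * (1 - q ^ (Suc i * W)) ^ (n - 1)
      / (\<Prod>j=1..n. 1 - q ^ (Suc i * (W div w (\<sigma> j))))) * (1 - q) / (1 - q) ^ m"
proof -
  define d where "d = n - 1"
  define v where "v j = w (\<sigma> j)" for j
  define V where "V = (\<Prod>j=1..d. v j)"
  define u where "u = v n"
  define e where "e = T_exponent d v"
  define K where "K = PiE {1..d} (\<lambda>j. {..<v j})"
  define Z where "Z k = q ^ (u * e k)" for k
  define y where "y i = padic_power q x ^ (W * i) * carlitz_coeff (q ^ V) i" for i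
  define F where "F l = (\<Sum>i\<le>l. of_nat (l choose i) * (- 1) ^ i * y i)" for l
  define b where "b = (1 - q ^ V) / (1 - q)"
  have n_eq: "n = Suc d" using n by (simp add: d_def)
  have v: "v j > 0" if "j \<in> {1..n}" for j using w[OF that] by (simp add: v_def)
  have V: "V > 0" unfolding V_def by (rule prod_pos) (use v n_eq in auto)
  have u: "u > 0" unfolding u_def by (rule v) (use n in auto)
  have W: "W = V * u"
    unfolding W_def V_def u_def v_def n_eq by simp
  have W_div: "W div v j = u * (\<Prod>i\<in>{1..d} - {j}. v i)" "(\<Prod>i\<in>{1..d} - {j}. v i) > 0" if j: "j \<in> {1..d}" for j
  proof -
    have "V = v j * (\<Prod>i\<in>{1..d} - {j}. v i)"
      unfolding V_def using j by (subst prod.remove[of _ j]) auto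
    with v[of j] j show "W div v j = u * (\<Prod>i\<in>{1..d} - {j}. v i)"
      by (simp add: W n_eq)
    show "(\<Prod>i\<in>{1..d} - {j}. v i) > 0"
      by (rule prod_pos) (use v n_eq in auto)
  qed
  have ne: "1 - q ^ r \<noteq> 0" if "r > 0" for r
    using power_neq_1[OF q that] by simp
  have qr: "absv (q ^ r - 1) < \<rho>" for r by (rule absv_power_minus_1_less[OF q(1)])
  have b: "b \<noteq> 0" using ne[OF V] q(2) by (simp add: b_def)
  have ux: "absv (of_nat u * x) \<le> 1"
    using absv_of_nat_mult_le[of u x] x by linarith
  have "padic_power (q ^ V) (of_nat u * x) = padic_power q x ^ W"
    unfolding padic_power_power[OF q(1) ux] padic_power_of_nat_mult[OF q(1) x] W
    by (simp only: power_mult[symmetric] mult.commute)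
  then have poly: "carlitz_poly l (q ^ V) (of_nat u * x) = F l / (1 - q ^ V) ^ l" for l
    using ne[OF V] by (simp add: carlitz_poly_eq[OF qr _ ux] F_def y_def power_mult)
  have T: "T_sum m (q ^ u) d v l = (\<Sum>k\<in>K. Z k ^ Suc l * ((1 - Z k) / (1 - q ^ u)) ^ (m - l))" for l
    unfolding T_sum_def K_def Z_def e_def
    by (simp add: q_bracket_of_nat[OF qr] power_mult[symmetric] mult_ac del: power_Suc mult_Suc)
  \<comment> \<open>The exponent \<open>l - 1\<close> is negative at \<open>l = 0\<close>; as
    \<open>b \<noteq> 0\<close>, splitting off \<open>1 / b\<close> leaves a natural power.\<close>
  have "C_sum m n w q x \<sigma> = (\<Sum>l\<le>m. of_nat (m choose l) * (b ^ l / b)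
      * ((1 - q ^ u) / (1 - q)) ^ (m - l) * (F l / (1 - q ^ V) ^ l)
      * (\<Sum>k\<in>K. Z k ^ Suc l * ((1 - Z k) / (1 - q ^ u)) ^ (m - l)))"
    unfolding C_sum_def v_def[symmetric] d_def[symmetric] V_def[symmetric] u_def[symmetric] poly T
    using b by (simp add: q_bracket_of_nat[OF q(1)] b_def[symmetric] power_int_diff)
  \<comment> \<open>The powers of \<open>1 - q ^ V\<close> cancel between \<open>b ^ l\<close> and
    the polynomial, those of \<open>1 - q ^ u\<close> between the bracket of \<open>u\<close> and
    the multiple sum. What remains is a Bernstein sum at \<open>Z k\<close>.\<close>
  also have "\<dots> = (\<Sum>l\<le>m. \<Sum>k\<in>K. Z k * (of_nat (m choose l) * Z k ^ l * (1 - Z k) ^ (m - l) * F l)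
      / (b * (1 - q) ^ m))"
    unfolding sum_distrib_left
  proof (intro sum.cong refl)
    fix l k assume "l \<in> {..m}"
    then have m: "(1 - q) ^ m = (1 - q) ^ l * (1 - q) ^ (m - l)"
      by (simp add: power_add[symmetric])
    show "of_nat (m choose l) * (b ^ l / b) * ((1 - q ^ u) / (1 - q)) ^ (m - l) * (F l / (1 - q ^ V) ^ l)
        * (Z k ^ Suc l * ((1 - Z k) / (1 - q ^ u)) ^ (m - l))
      = Z k * (of_nat (m choose l) * Z k ^ l * (1 - Z k) ^ (m - l) * F l) / (b * (1 - q) ^ m)"
      unfolding m power_divide b_def[THEN arg_cong, of "\<lambda>z. z ^ l"]
      using ne[OF u] ne[OF V] by (simp add: mult_ac)
  qed
  also have "\<dots> = (\<Sum>k\<in>K. Z k * (\<Sum>l\<le>m. of_nat (m choose l) * Z k ^ l * (1 - Z k) ^ (m - l) * F l))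
      / (b * (1 - q) ^ m)"
    unfolding sum_divide_distrib sum_distrib_left by (rule sum.swap)
  also have "\<dots> = (\<Sum>k\<in>K. Z k * (\<Sum>i\<le>m. of_nat (m choose i) * (- 1) ^ i * Z k ^ i * y i)) / (b * (1 - q) ^ m)"
    unfolding F_def sum_bernstein_binomial_transform ..
  also have "(\<Sum>k\<in>K. Z k * (\<Sum>i\<le>m. of_nat (m choose i) * (- 1) ^ i * Z k ^ i * y i))
      = (\<Sum>i\<le>m. of_nat (m choose i) * (- 1) ^ i * y i * (\<Sum>k\<in>K. Z k ^ Suc i))"
    unfolding sum_distrib_left by (subst sum.swap) (simp add: mult_ac)
  also have "\<dots> / (b * (1 - q) ^ m) = (\<Sum>i\<le>m. of_nat (m choose i) * (- 1) ^ i * padic_power q x ^ (W * i)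
      * of_nat (Suc i) * (1 - q ^ (Suc i * W)) ^ d
      / (\<Prod>j=1..n. 1 - q ^ (Suc i * (W div v j)))) * (1 - q) / (1 - q) ^ m"
    unfolding sum_divide_distrib sum_distrib_right
  proof (intro sum.cong refl)
    fix i
    have "(\<Sum>k\<in>K. Z k ^ Suc i) = (\<Sum>k\<in>K. (q ^ (Suc i * u)) ^ T_exponent d v k)"
      unfolding Z_def e_def by (simp only: power_mult[symmetric] mult_ac)
    also have "\<dots> = (\<Prod>j=1..d. (1 - (q ^ (Suc i * u)) ^ (\<Prod>i=1..d. v i))
        / (1 - (q ^ (Suc i * u)) ^ (\<Prod>i\<in>{1..d} - {j}. v i)))"
      unfolding K_def
    proof (rule sum_power_T_exponent)
      fix j assume "j \<in> {1..d}"
      then show "(q ^ (Suc i * u)) ^ (\<Prod>i\<in>{1..d} - {j}. v i) \<noteq> 1"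
        unfolding power_mult[symmetric] using u W_div(2)[of j] by (intro power_neq_1[OF q]) auto
    qed
    also have "\<dots> = (\<Prod>j=1..d. (1 - q ^ (Suc i * W)) / (1 - q ^ (Suc i * (W div v j))))"
      by (intro prod.cong refl) (simp only: V_def[symmetric] power_mult[symmetric] W W_div(1)[unfolded W] mult_ac)
    also have "\<dots> = (1 - q ^ (Suc i * W)) ^ d / (\<Prod>j=1..d. 1 - q ^ (Suc i * (W div v j)))"
      by (simp add: prod_dividef)
    finally have sumZ: "(\<Sum>k\<in>K. Z k ^ Suc i)
        = (1 - q ^ (Suc i * W)) ^ d / (\<Prod>j=1..d. 1 - q ^ (Suc i * (W div v j)))" .
    \<comment> \<open>The denominator of \<open>carlitz_coeff (q ^ V) i\<close> is thus the missing
      factor \<open>j = n\<close>, and its numerator \<open>1 - q ^ V\<close> cancels against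
      \<open>b\<close>. The last weight, distinguished so far, joins the others.\<close>
    have "W div v n = V"
      using u by (simp add: W u_def)
    then have prod_n: "(\<Prod>j=1..n. 1 - q ^ (Suc i * (W div v j)))
        = (\<Prod>j=1..d. 1 - q ^ (Suc i * (W div v j))) * (1 - (q ^ V) ^ Suc i)"
      unfolding n_eq by (simp add: power_mult[symmetric] mult_ac del: power_Suc mult_Suc)
    show "of_nat (m choose i) * (- 1) ^ i * y i * (\<Sum>k\<in>K. Z k ^ Suc i) / (b * (1 - q) ^ m)
      = of_nat (m choose i) * (- 1) ^ i * padic_power q x ^ (W * i)
      * of_nat (Suc i) * (1 - q ^ (Suc i * W)) ^ d
      / (\<Prod>j=1..n. 1 - q ^ (Suc i * (W div v j))) * (1 - q) / (1 - q) ^ m"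
      unfolding sumZ prod_n y_def carlitz_coeff_def b_def
      using ne[OF V] q(2) by (simp add: mult_ac del: power_Suc mult_Suc of_nat_Suc)
  qed
  finally show ?thesis
    unfolding v_def d_def .
qed

end

theorem theorem2p3:
  fixes p m n :: nat
    and w \<sigma> \<tau> :: "nat \<Rightarrow> nat"
    and q x :: "'a::complete_ultrametric_field"
  assumes "prime p"
    and "is_padic_complex p TYPE('a)"
    and "q \<noteq> 1"
    and "absv (1 - q) < real p powr (- (1 / (real p - 1)))"
    and "n \<ge> 1"
    and "\<And>i. i \<in> {1..n} \<Longrightarrow> w i > 0"
    and "x \<in> padic_integers"
    and "\<sigma> permutes {1..n}"
    and "\<tau> permutes {1..n}"
  shows "C_sum m n w q x \<sigma> = C_sum m n w q x \<tau>"
proof -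
  interpret padic_complex p "TYPE('a)"
    by standard (fact assms(1), fact assms(2))
  have q: "absv (q - 1) < exp_radius p"
    using assms(4) by (simp add: exp_radius_def absv_minus_commute)
  have x: "absv x \<le> 1"
    using assms(7) by (simp add: padic_integers_def)
  \<comment> \<open>The closed form involves the permutation only through these two products over
    all indices.\<close>
  have perm: "(\<Prod>j=1..n. w (\<pi> j)) = (\<Prod>j=1..n. w j)"
    "(\<Prod>j=1..n. 1 - q ^ (k * (N div w (\<pi> j)))) = (\<Prod>j=1..n. 1 - q ^ (k * (N div w j)))"
    if "\<pi> permutes {1..n}" for \<pi> k N
    using prod.permute[OF that, of w] prod.permute[OF that, of "\<lambda>j. 1 - q ^ (k * (N div w j))"]
    by (simp_all add: comp_def)
  have pos: "w (\<pi> j) > 0" if "\<pi> permutes {1..n}" "j \<in> {1..n}" for \<pi> j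
    using assms(6) permutes_in_image[OF that(1)] that(2) by blast
  show ?thesis
    by (simp only: C_sum_eq[OF q assms(3) x assms(5)] pos[OF assms(8)] pos[OF assms(9)]
        perm[OF assms(8)] perm[OF assms(9)])
qed

end
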